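(* Let $(X,d)$ be a computable metric space and $(X,e,\circ,\cdot^{-1})$ a compact topological group (with respect to the topology of $d$). Suppose $d$ is bi-invariant, i.e. $d(a\circ c,b\circ c)=d(a,b)=d(c\circ a,c\circ b)$ for all $a,b,c\in X$, and suppose the size of maximum packings $\kappa_X:\mathbb{N}\to\mathbb{N}$ is computable. Then the Haar integral $\mathcal{C}(X)\ni f\mapsto\int_X f\,d\mu\in\mathbb{R}$ is computable, where $\mu$ is the Haar probability measure of the group.
   Context: A computable metric space comes with a dense sequence $\xi:\mathbb{N}\to X$ such that $(a,b)\mapsto d(\xi(a),\xi(b))$ is computable; points are represented by fast converging sequences from it, and $\mathcal{C}(X)$ is the represented space of continuous functions $X\to\mathbb{R}$ (evaluation computable). The group operations $\circ$, $e$, $\cdot^{-1}$ are not assumed computable. For $U\subseteq X$, an $n$-packing of $U$ is a set $T\subseteq U$ with $d(x,y)>2^{-n}$ for all distinct $x,y\in T$; it is maximum if $|T|\ge|S|$ for every $n$-packing $S$ of $U$. $\kappa_X(n)$ denotes the cardinality of a maximum $n$-packing of $X$. *)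

theory Defs
  imports "HOL-Probability.Probability_Measure" "HOL-Library.Nat_Bijection"
    "HOL-Library.Equipollence"
begin

text \<open>
  Unbounded search is undefined as soon as an undefined value is met before the first zero.
\<close>

definition mu_search :: "(nat \<Rightarrow> nat option) \<Rightarrow> nat option" where
  "mu_search h =
    (if \<exists>n. h n = Some 0 \<and> (\<forall>m<n. \<exists>k. h m = Some (Suc k))
     then Some (LEAST n. h n = Some 0) else None)"

text \<open>
  The partial recursive functionals \<open>\<Phi> p n\<close> relative to an oracle \<open>p\<close>, uniformly in \<open>p\<close>:
  the unary presentation of the partial recursive functions (arguments are tupled by Cantor's
  pairing function \<^const>\<open>prod_encode\<close>), extended by queries to \<open>p\<close>.
  The identity is \<open>pair left right\<close>.
\<close>

inductive oracle_recursive :: "((nat \<Rightarrow> nat) \<Rightarrow> nat \<Rightarrow> nat option) \<Rightarrow> bool" where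
  zero: "oracle_recursive (\<lambda>p n. Some 0)"
| succ: "oracle_recursive (\<lambda>p n. Some (Suc n))"
| left: "oracle_recursive (\<lambda>p n. Some (fst (prod_decode n)))"
| right: "oracle_recursive (\<lambda>p n. Some (snd (prod_decode n)))"
| query: "oracle_recursive (\<lambda>p n. Some (p n))"
| pair: "oracle_recursive \<Phi> \<Longrightarrow> oracle_recursive \<Psi> \<Longrightarrow>
    oracle_recursive (\<lambda>p n.
      Option.bind (\<Phi> p n) (\<lambda>a. Option.bind (\<Psi> p n) (\<lambda>b. Some (prod_encode (a, b)))))"
| comp: "oracle_recursive \<Phi> \<Longrightarrow> oracle_recursive \<Psi> \<Longrightarrow>
    oracle_recursive (\<lambda>p n. Option.bind (\<Psi> p n) (\<Phi> p))"
| prec: "oracle_recursive \<Phi> \<Longrightarrow> oracle_recursive \<Psi> \<Longrightarrow>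
    oracle_recursive (\<lambda>p n. case prod_decode n of (a, k) \<Rightarrow>
      rec_nat (\<Phi> p a)
        (\<lambda>j r. Option.bind r (\<lambda>i. \<Psi> p (prod_encode (a, prod_encode (j, i))))) k)"
| search: "oracle_recursive \<Phi> \<Longrightarrow>
    oracle_recursive (\<lambda>p a. mu_search (\<lambda>n. \<Phi> p (prod_encode (a, n))))"

text \<open>
  \<open>\<delta> p x\<close> means that \<open>p\<close> is a name of \<open>x\<close>. Points without a name lie outside the represented
  space, so computability of a map on a function type such as \<open>'a \<Rightarrow> real\<close> only concerns
  those functions that have a name.
\<close>

type_synonym 'a representation = "(nat \<Rightarrow> nat) \<Rightarrow> 'a \<Rightarrow> bool"

definition computable_map ::
    "'a representation \<Rightarrow> 'b representation \<Rightarrow> ('a \<Rightarrow> 'b) \<Rightarrow> bool" where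
  "computable_map \<delta> \<delta>' f \<longleftrightarrow>
    (\<exists>\<Phi>. oracle_recursive \<Phi> \<and>
      (\<forall>p x. \<delta> p x \<longrightarrow> (\<exists>q. (\<forall>n. \<Phi> p n = Some (q n)) \<and> \<delta>' q (f x))))"

definition rep_nat :: "nat representation" where
  "rep_nat p n \<longleftrightarrow> p 0 = n"

definition rep_prod ::
    "'a representation \<Rightarrow> 'b representation \<Rightarrow> ('a \<times> 'b) representation" where
  "rep_prod \<delta> \<delta>' p z \<longleftrightarrow>
    \<delta> (\<lambda>n. p (2 * n)) (fst z) \<and> \<delta>' (\<lambda>n. p (2 * n + 1)) (snd z)"

definition rep_metric :: "(nat \<Rightarrow> 'a::metric_space) \<Rightarrow> 'a representation" where
  "rep_metric \<xi> p x \<longleftrightarrow> (\<forall>n. dist (\<xi> (p n)) x \<le> 1 / 2 ^ n)"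

definition rat_seq :: "nat \<Rightarrow> real" where
  "rat_seq n = (case prod_decode n of (m, c) \<Rightarrow>
     case prod_decode m of (a, b) \<Rightarrow> (real a - real b) / real (Suc c))"

definition rep_reals :: "real representation" where
  "rep_reals = rep_metric rat_seq"

definition computable_metric_space :: "(nat \<Rightarrow> 'a::metric_space) \<Rightarrow> bool" where
  "computable_metric_space \<xi> \<longleftrightarrow>
    closure (range \<xi>) = UNIV \<and>
    computable_map (rep_prod rep_nat rep_nat) rep_reals (\<lambda>(a, b). dist (\<xi> a) (\<xi> b))"

text \<open>
  Application in Kleene's second algebra: \<open>p\<close>, read as an associate, maps \<open>q\<close> to \<open>r\<close>. Given
  an output position \<open>n\<close>, \<open>p\<close> is asked about longer and longer prefixes of \<open>q\<close>; the answer \<open>0\<close>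
  means that the prefix is too short, and the first answer \<open>Suc m\<close> means that \<open>r n = m\<close>.
\<close>

definition kleene_apply :: "(nat \<Rightarrow> nat) \<Rightarrow> (nat \<Rightarrow> nat) \<Rightarrow> (nat \<Rightarrow> nat) \<Rightarrow> bool" where
  "kleene_apply p q r \<longleftrightarrow>
    (\<forall>n. \<exists>k. p (prod_encode (n, list_encode (map q [0..<k]))) = Suc (r n) \<and>
      (\<forall>j<k. p (prod_encode (n, list_encode (map q [0..<j]))) = 0))"

text \<open>
  The function space of represented spaces: names of \<open>f\<close> are the associates of its continuous
  realizers. This makes evaluation computable, and currying as well.
\<close>

definition rep_fun ::
    "'a representation \<Rightarrow> 'b representation \<Rightarrow> ('a \<Rightarrow> 'b) representation" where
  "rep_fun \<delta> \<delta>' p f \<longleftrightarrow>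
    (\<forall>q x. \<delta> q x \<longrightarrow> (\<exists>r. kleene_apply p q r \<and> \<delta>' r (f x)))"

text \<open>
  If \<open>\<xi>\<close> is dense, the second conjunct already implies continuity, and conversely every
  continuous function has such a name.
\<close>

definition rep_continuous ::
    "(nat \<Rightarrow> 'a::metric_space) \<Rightarrow> ('a \<Rightarrow> real) representation" where
  "rep_continuous \<xi> p f \<longleftrightarrow>
    continuous_on UNIV f \<and> rep_fun (rep_metric \<xi>) rep_reals p f"

definition packing :: "nat \<Rightarrow> 'a::metric_space set \<Rightarrow> 'a set \<Rightarrow> bool" where
  "packing n U T \<longleftrightarrow>
    T \<subseteq> U \<and> (\<forall>x\<in>T. \<forall>y\<in>T. x \<noteq> y \<longrightarrow> dist x y > 1 / 2 ^ n)"

definition maximum_packing :: "nat \<Rightarrow> 'a::metric_space set \<Rightarrow> 'a set \<Rightarrow> bool" where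
  "maximum_packing n U T \<longleftrightarrow> packing n U T \<and> (\<forall>S. packing n U S \<longrightarrow> S \<lesssim> T)"

text \<open>
  Meaningful for totally bounded \<open>U\<close>, where maximum packings exist and are finite.
\<close>

definition packing_number :: "'a::metric_space set \<Rightarrow> nat \<Rightarrow> nat" where
  "packing_number U n = (THE k. \<exists>T. maximum_packing n U T \<and> card T = k)"

definition topological_group ::
    "('a::topological_space \<Rightarrow> 'a \<Rightarrow> 'a) \<Rightarrow> 'a \<Rightarrow> ('a \<Rightarrow> 'a) \<Rightarrow> bool" where
  "topological_group mul e minv \<longleftrightarrow>
    group mul e minv \<and>
    continuous_on UNIV (\<lambda>(x, y). mul x y) \<and> continuous_on UNIV minv"

definition bi_invariant :: "('a::metric_space \<Rightarrow> 'a \<Rightarrow> 'a) \<Rightarrow> bool" where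
  "bi_invariant mul \<longleftrightarrow>
    (\<forall>a b c. dist (mul a c) (mul b c) = dist a b \<and> dist a b = dist (mul c a) (mul c b))"

text \<open>
  On a compact metrizable group regularity is automatic, and left invariance of a probability
  measure implies right invariance.
\<close>

definition haar_probability ::
    "('a::topological_space \<Rightarrow> 'a \<Rightarrow> 'a) \<Rightarrow> 'a measure \<Rightarrow> bool" where
  "haar_probability mul \<mu> \<longleftrightarrow>
    prob_space \<mu> \<and> sets \<mu> = sets borel \<and>
    (\<forall>g. \<forall>A\<in>sets borel. emeasure \<mu> (mul g ` A) = emeasure \<mu> A)"

end

theory Submission imports Defs begin

text \<open>
  Let \<open>T\<close> be a maximum \<open>N\<close>-packing. By bi-invariance its translates \<open>T \<circ> x\<close> are maximum packings,
  too, and any two maximum packings satisfy Hall's condition for being matched with displacement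
  at most \<open>1 / 2 ^ N\<close>. Hence the average of \<open>f\<close> over \<open>T \<circ> x\<close> differs from the average over \<open>T\<close> by at
  most the oscillation of \<open>f\<close> at scale \<open>1 / 2 ^ N\<close>. Integrating over \<open>x\<close> turns the former average
  into the Haar integral, by left invariance. Since the packing number is known, a packing by
  points of the dense sequence can be recognised as maximum; unbounded search finds one
  together with prefixes of names on which the associate of \<open>f\<close> is already decided and which cover
  the balls of radius \<open>1 / 2 ^ N\<close> around its points. This bounds the oscillation without ever
  computing a modulus of continuity or the group operations.
\<close>

section \<open>Total recursive functionals\<close>

definition pi1 :: "nat \<Rightarrow> nat" where "pi1 n = fst (prod_decode n)"
definition pi2 :: "nat \<Rightarrow> nat" where "pi2 n = snd (prod_decode n)"

lemma pi1_prod_encode [simp]: "pi1 (prod_encode (a, b)) = a"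
  and pi2_prod_encode [simp]: "pi2 (prod_encode (a, b)) = b"
  and prod_encode_pi [simp]: "prod_encode (pi1 n, pi2 n) = n"
  and prod_decode_pi: "prod_decode n = (pi1 n, pi2 n)"
  by (simp_all add: pi1_def pi2_def)

text \<open>Since 0 codes the empty list, this keeps the tail operation \<open>pi2 (r - 1)\<close>
  at 0 once a sequence code is exhausted.\<close>

lemma pi2_0 [simp]: "pi2 0 = 0"
  by (simp add: pi2_def prod_decode_def prod_decode_aux.simps)

definition total_recursive :: "((nat \<Rightarrow> nat) \<Rightarrow> nat \<Rightarrow> nat) \<Rightarrow> bool" where
  "total_recursive F \<longleftrightarrow> oracle_recursive (\<lambda>p n. Some (F p n))"

text \<open>The closure rules follow the syntax of a functional, so recursiveness is proved by
  writing the functional out and decomposing it.\<close>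

named_theorems rec_intros

lemma total_recursive_comp:
  assumes "total_recursive F" "total_recursive G"
  shows "total_recursive (\<lambda>p n. F p (G p n))"
  using oracle_recursive.comp[OF assms[unfolded total_recursive_def]]
  by (simp add: total_recursive_def)

lemma total_recursive_pair [rec_intros]:
  assumes "total_recursive F" "total_recursive G"
  shows "total_recursive (\<lambda>p n. prod_encode (F p n, G p n))"
  using oracle_recursive.pair[OF assms[unfolded total_recursive_def]]
  by (simp add: total_recursive_def)

lemma total_recursive_pi1 [rec_intros]:
  "total_recursive F \<Longrightarrow> total_recursive (\<lambda>p n. pi1 (F p n))"
  by (rule total_recursive_comp[of "\<lambda>p. pi1"])
    (simp_all add: total_recursive_def pi1_def oracle_recursive.left)

lemma total_recursive_pi2 [rec_intros]:
  "total_recursive F \<Longrightarrow> total_recursive (\<lambda>p n. pi2 (F p n))"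
  by (rule total_recursive_comp[of "\<lambda>p. pi2"])
    (simp_all add: total_recursive_def pi2_def oracle_recursive.right)

lemma total_recursive_id [rec_intros]: "total_recursive (\<lambda>p n. n)"
  using oracle_recursive.pair[OF oracle_recursive.left oracle_recursive.right]
  by (simp add: total_recursive_def)

lemma total_recursive_Suc [rec_intros]:
  "total_recursive F \<Longrightarrow> total_recursive (\<lambda>p n. Suc (F p n))"
  by (rule total_recursive_comp[of "\<lambda>p. Suc"])
    (simp_all add: total_recursive_def oracle_recursive.succ)

lemma total_recursive_query [rec_intros]:
  "total_recursive F \<Longrightarrow> total_recursive (\<lambda>p n. p (F p n))"
  by (rule total_recursive_comp[of "\<lambda>p. p"])
    (simp_all add: total_recursive_def oracle_recursive.query)

lemma total_recursive_const [rec_intros]: "total_recursive (\<lambda>p n. k)"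
proof (induction k)
  case 0
  show ?case by (simp add: total_recursive_def oracle_recursive.zero)
next
  case (Suc k)
  then show ?case by (rule total_recursive_Suc)
qed

text \<open>The constructor \<open>prec\<close> hands its step a coded triple: parameter, index,
  previous value. The whole input \<open>n\<close> serves as the parameter, and composition with
  \<open>n \<mapsto> (n, K p n)\<close> supplies the length.\<close>

lemma total_recursive_rec [rec_intros]:
  assumes B: "total_recursive B" and K: "total_recursive K"
    and S: "total_recursive (\<lambda>p z. S p (pi1 z) (pi1 (pi2 z)) (pi2 (pi2 z)))"
  shows "total_recursive (\<lambda>p n. rec_nat (B p n) (S p n) (K p n))"
proof -
  \<comment> \<open>The redundant projections of encoded triples reproduce the instance of
    \<open>oracle_recursive.prec\<close> literally.\<close>
  let ?\<Phi> = "\<lambda>p n. case prod_decode n of (a, k) \<Rightarrow>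
    rec_nat (Some (B p a)) (\<lambda>j r. Option.bind r (\<lambda>i. Some (S p
      (pi1 (prod_encode (a, prod_encode (j, i))))
      (pi1 (pi2 (prod_encode (a, prod_encode (j, i)))))
      (pi2 (pi2 (prod_encode (a, prod_encode (j, i)))))))) k"
  have "rec_nat (Some (B p a)) (\<lambda>j r. Option.bind r (\<lambda>i. Some (S p a j i))) k =
      Some (rec_nat (B p a) (S p a) k)" for p a k
    by (induction k) auto
  then have "?\<Phi> = (\<lambda>p n. Some (rec_nat (B p (pi1 n)) (S p (pi1 n)) (pi2 n)))"
    by (simp add: prod_decode_pi)
  then have "total_recursive (\<lambda>p n. rec_nat (B p (pi1 n)) (S p (pi1 n)) (pi2 n))"
    using oracle_recursive.prec[OF B[unfolded total_recursive_def] S[unfolded total_recursive_def]]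
    by (simp add: total_recursive_def)
  from total_recursive_comp[OF this total_recursive_pair[OF total_recursive_id K]]
  show ?thesis by simp
qed

lemma total_recursive_add [rec_intros]:
  assumes "total_recursive F" "total_recursive G"
  shows "total_recursive (\<lambda>p n. F p n + G p n)"
proof -
  have "rec_nat a (\<lambda>_ r. Suc r) b = a + b" for a b
    by (induction b) auto
  moreover have "total_recursive (\<lambda>p n. rec_nat (F p n) (\<lambda>_ r. Suc r) (G p n))"
    by (intro rec_intros assms)
  ultimately show ?thesis by simp
qed

lemma total_recursive_mult [rec_intros]:
  assumes F: "total_recursive F" and G: "total_recursive G"
  shows "total_recursive (\<lambda>p n. F p n * G p n)"
proof -
  have "rec_nat 0 (\<lambda>_ r. r + a) b = a * b" for a b
    by (induction b) auto
  moreover have "total_recursive (\<lambda>p n. rec_nat 0 (\<lambda>_ r. r + F p n) (G p n))"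
    \<comment> \<open>In the recursion step \<open>F\<close> is evaluated at the projection to the
      parameter, hence the composition rule.\<close>
    by (intro rec_intros G total_recursive_comp[OF F])
  ultimately show ?thesis by simp
qed

lemma total_recursive_pow2 [rec_intros]:
  assumes "total_recursive F"
  shows "total_recursive (\<lambda>p n. 2 ^ F p n)"
proof -
  have "rec_nat 1 (\<lambda>_ r. r + r) b = (2::nat) ^ b" for b
    by (induction b) auto
  moreover have "total_recursive (\<lambda>p n. rec_nat 1 (\<lambda>_ r. r + r) (F p n))"
    by (intro rec_intros assms)
  ultimately show ?thesis by simp
qed

lemma total_recursive_diff [rec_intros]:
  assumes F: "total_recursive F" and G: "total_recursive G"
  shows "total_recursive (\<lambda>p n. F p n - G p n)"
proof -
  \<comment> \<open>Predecessor by recursion: the last step returns its own index.\<close>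
  have *: "rec_nat 0 (\<lambda>j _. j) b = b - 1" for b :: nat
    by (cases b) auto
  have pred: "total_recursive (\<lambda>p n. H p n - 1)" if "total_recursive H" for H
    unfolding *[symmetric] by (intro rec_intros that)
  have "rec_nat a (\<lambda>_ r. r - 1) b = a - b" for a b :: nat
    by (induction b) auto
  moreover have "total_recursive (\<lambda>p n. rec_nat (F p n) (\<lambda>_ r. r - 1) (G p n))"
    by (intro rec_intros pred F G)
  ultimately show ?thesis by simp
qed

text \<open>Zero encodes truth, since the search operator looks for a zero.\<close>

definition recursive_pred :: "((nat \<Rightarrow> nat) \<Rightarrow> nat \<Rightarrow> bool) \<Rightarrow> bool" where
  "recursive_pred P \<longleftrightarrow> total_recursive (\<lambda>p n. if P p n then 0 else 1)"

text \<open>The characteristic value of \<open>P\<close> acts as a recursion length: zero steps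
  leave \<open>F\<close>, one step replaces it by \<open>G\<close>.\<close>

lemma total_recursive_if [rec_intros]:
  assumes P: "recursive_pred P" and F: "total_recursive F" and G: "total_recursive G"
  shows "total_recursive (\<lambda>p n. if P p n then F p n else G p n)"
proof -
  have "rec_nat a (\<lambda>_ _. b) (if Q then 0 else 1) = (if Q then a else b)" for a b :: nat and Q
    by simp
  moreover have "total_recursive (\<lambda>p n. rec_nat (F p n) (\<lambda>_ _. G p n) (if P p n then 0 else 1))"
    using P by (intro rec_intros F total_recursive_comp[OF G]) (simp add: recursive_pred_def)
  ultimately show ?thesis by simp
qed

lemma recursive_pred_eq_0:
  assumes "total_recursive F"
  shows "recursive_pred (\<lambda>p n. F p n = 0)"
proof -
  have "rec_nat 0 (\<lambda>_ _. 1) a = (if a = 0 then 0 else 1 :: nat)" for a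
    by (cases a) auto
  moreover have "total_recursive (\<lambda>p n. rec_nat 0 (\<lambda>_ _. 1) (F p n))"
    by (intro rec_intros assms)
  ultimately show ?thesis by (simp only: recursive_pred_def)
qed

lemma recursive_pred_le [rec_intros]:
  assumes "total_recursive F" "total_recursive G"
  shows "recursive_pred (\<lambda>p n. F p n \<le> G p n)"
  using recursive_pred_eq_0[OF total_recursive_diff[OF assms]] by simp

lemma recursive_pred_not [rec_intros]:
  assumes "recursive_pred P"
  shows "recursive_pred (\<lambda>p n. \<not> P p n)"
proof -
  have "total_recursive (\<lambda>p n. if P p n then 1 else 0)"
    by (intro rec_intros assms)
  moreover have "(if Q then 1 else 0) = (if \<not> Q then 0 else 1 :: nat)" for Q
    by simp
  ultimately show ?thesis by (simp only: recursive_pred_def)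
qed

lemma recursive_pred_conj [rec_intros]:
  assumes "recursive_pred P" "recursive_pred Q"
  shows "recursive_pred (\<lambda>p n. P p n \<and> Q p n)"
proof -
  have "total_recursive (\<lambda>p n. if P p n then (if Q p n then 0 else 1) else 1)"
    by (intro rec_intros assms)
  moreover have "(if P p n then (if Q p n then 0 else 1) else 1) =
      (if P p n \<and> Q p n then 0 else 1 :: nat)" for p n
    by simp
  ultimately show ?thesis by (simp add: recursive_pred_def)
qed

lemma recursive_pred_imp [rec_intros]:
  assumes "recursive_pred P" "recursive_pred Q"
  shows "recursive_pred (\<lambda>p n. P p n \<longrightarrow> Q p n)"
proof -
  have "recursive_pred (\<lambda>p n. \<not> (P p n \<and> \<not> Q p n))"
    by (intro rec_intros assms)
  then show ?thesis by simp
qed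

lemma recursive_pred_eq [rec_intros]:
  assumes "total_recursive F" "total_recursive G"
  shows "recursive_pred (\<lambda>p n. F p n = G p n)"
  unfolding eq_iff by (intro rec_intros assms)

text \<open>A failing index sets the accumulator to 1, and later successes merely preserve
  it.\<close>

lemma recursive_pred_all_less [rec_intros]:
  assumes K: "total_recursive K"
    and P: "recursive_pred (\<lambda>p z. P p (pi1 z) (pi2 z))"
  shows "recursive_pred (\<lambda>p n. \<forall>i<K p n. P p n i)"
proof -
  have "rec_nat 0 (\<lambda>j r. if Q j then r else 1) k = (if \<forall>i<k. Q i then 0 else 1 :: nat)" for Q k
    by (induction k) (auto simp: less_Suc_eq)
  moreover have "recursive_pred (\<lambda>p z. P p (pi1 z) (pi1 (pi2 z)))"
  proof -
    have "total_recursive (\<lambda>p z. prod_encode (pi1 z, pi1 (pi2 z)))"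
      by (intro rec_intros)
    from total_recursive_comp[OF P[unfolded recursive_pred_def] this]
    show ?thesis by (simp add: recursive_pred_def)
  qed
  then have "total_recursive (\<lambda>p n. rec_nat 0 (\<lambda>j r. if P p n j then r else 1) (K p n))"
    by (intro rec_intros K)
  ultimately show ?thesis by (simp add: recursive_pred_def)
qed

subsection \<open>Sequence codes\<close>

text \<open>As \<open>list_encode (x # xs)\<close> is
  \<open>Suc (prod_encode (x, list_encode xs))\<close>, \<open>pi1 (r - 1)\<close> is the head and
  \<open>pi2 (r - 1)\<close> the tail. Every number thereby codes an infinite sequence.\<close>

definition nth_code :: "nat \<Rightarrow> nat \<Rightarrow> nat" where
  "nth_code c j = pi1 (rec_nat c (\<lambda>_ r. pi2 (r - 1)) j - 1)"

lemma total_recursive_nth_code [rec_intros]: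
  "total_recursive F \<Longrightarrow> total_recursive G \<Longrightarrow> total_recursive (\<lambda>p n. nth_code (F p n) (G p n))"
  unfolding nth_code_def by (intro rec_intros)

lemma ex_nth_code: "\<exists>c. \<forall>j<k. nth_code c j = h j"
proof -
  have *: "rec_nat (list_encode xs) (\<lambda>_ r. pi2 (r - 1)) j = list_encode (drop j xs)" for xs j
  proof (induction j)
    case (Suc j)
    then show ?case
    proof (cases "drop j xs")
      case Nil
      then have "drop (Suc j) xs = []" by simp
      then show ?thesis using Suc Nil by (simp del: drop_eq_Nil drop_eq_Nil2)
    next
      case (Cons y ys)
      then have "drop (Suc j) xs = ys"
        by (metis drop_Suc list.sel(3) tl_drop)
      then show ?thesis using Suc Cons by simp
    qed
  qed simp
  have "nth_code (list_encode xs) j = xs ! j" if "j < length xs" for xs j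
    using that by (simp add: nth_code_def * del: One_nat_def flip: Cons_nth_drop_Suc)
  then have "\<forall>j<k. nth_code (list_encode (map h [0..<k])) j = h j"
    by simp
  then show ?thesis by blast
qed

text \<open>An associate is asked about a list of exact length \<open>k\<close>, whereas
  \<open>c\<close> may code a longer or shorter list.\<close>

definition prefix_code :: "nat \<Rightarrow> nat \<Rightarrow> nat" where
  "prefix_code c k = list_encode (map (nth_code c) [0..<k])"

text \<open>List codes grow at the front, so the prefix is assembled from its last entry
  backwards.\<close>

lemma total_recursive_prefix_code [rec_intros]:
  assumes F: "total_recursive F" and G: "total_recursive G"
  shows "total_recursive (\<lambda>p n. prefix_code (F p n) (G p n))"
proof -
  have "rec_nat 0 (\<lambda>j r. Suc (prod_encode (nth_code c (k - Suc j), r))) i =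
      list_encode (map (nth_code c) [k - i..<k])" if "i \<le> k" for c k i
    using that
  proof (induction i)
    case (Suc i)
    then have "[k - Suc i..<k] = (k - Suc i) # [k - i..<k]"
      by (simp add: upt_conv_Cons Suc_diff_Suc)
    then show ?case using Suc by simp
  qed simp
  from this[OF order_refl]
  have "rec_nat 0 (\<lambda>j r. Suc (prod_encode (nth_code c (k - Suc j), r))) k = prefix_code c k" for c k
    by (simp add: prefix_code_def)
  moreover have "total_recursive (\<lambda>p n. rec_nat 0
      (\<lambda>j r. Suc (prod_encode (nth_code (F p n) (G p n - Suc j), r))) (G p n))"
    by (intro rec_intros G total_recursive_comp[OF F] total_recursive_comp[OF G])
  ultimately show ?thesis by simp
qed

subsection \<open>Rational-valued functionals\<close>

text \<open>Values are exact, but the index is arbitrary, as \<open>rat_seq\<close> is not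
  injective.\<close>

definition rat_recursive :: "((nat \<Rightarrow> nat) \<Rightarrow> nat \<Rightarrow> real) \<Rightarrow> bool" where
  "rat_recursive R \<longleftrightarrow> (\<exists>F. total_recursive F \<and> (\<forall>p n. rat_seq (F p n) = R p n))"

lemma rat_seq_pi: "rat_seq n = (real (pi1 (pi1 n)) - real (pi2 (pi1 n))) / real (Suc (pi2 n))"
  by (simp add: rat_seq_def prod_decode_pi)

lemma rat_recursive_rat_seq [rec_intros]:
  "total_recursive F \<Longrightarrow> rat_recursive (\<lambda>p n. rat_seq (F p n))"
  unfolding rat_recursive_def by blast

lemma rat_recursive_inverse_pow2 [rec_intros]:
  assumes "total_recursive F"
  shows "rat_recursive (\<lambda>p n. 1 / 2 ^ F p n)"
  unfolding rat_recursive_def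
proof (intro exI conjI allI)
  \<comment> \<open>A rational is coded by a numerator, as a difference of two naturals, and the
    predecessor of its denominator.\<close>
  show "total_recursive (\<lambda>p n. prod_encode (prod_encode (1, 0), 2 ^ F p n - 1))"
    by (intro rec_intros assms)
  show "rat_seq (prod_encode (prod_encode (1, 0), 2 ^ F p n - 1)) = 1 / 2 ^ F p n" for p n
    by (simp add: rat_seq_pi of_nat_diff)
qed

definition rat_add :: "nat \<Rightarrow> nat \<Rightarrow> nat" where
  "rat_add u v = prod_encode (prod_encode
    (pi1 (pi1 u) * Suc (pi2 v) + pi1 (pi1 v) * Suc (pi2 u),
     pi2 (pi1 u) * Suc (pi2 v) + pi2 (pi1 v) * Suc (pi2 u)),
    Suc (pi2 u) * Suc (pi2 v) - 1)"

lemma rat_seq_rat_add: "rat_seq (rat_add u v) = rat_seq u + rat_seq v"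
proof -
  have *: "real (Suc (Suc a * Suc b - 1)) = (1 + real a) * (1 + real b)" for a b
    by (simp add: algebra_simps)
  show ?thesis
    unfolding rat_add_def rat_seq_pi pi1_prod_encode pi2_prod_encode *
    by (simp add: divide_simps) (simp add: algebra_simps)
qed

lemma total_recursive_rat_add [rec_intros]:
  "total_recursive F \<Longrightarrow> total_recursive G \<Longrightarrow> total_recursive (\<lambda>p n. rat_add (F p n) (G p n))"
  unfolding rat_add_def by (intro rec_intros)

lemma rat_recursive_add [rec_intros]:
  assumes "rat_recursive R" "rat_recursive S"
  shows "rat_recursive (\<lambda>p n. R p n + S p n)"
proof -
  obtain F where F: "total_recursive F" "\<And>p n. rat_seq (F p n) = R p n"
    using assms(1) unfolding rat_recursive_def by blast
  obtain G where G: "total_recursive G" "\<And>p n. rat_seq (G p n) = S p n"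
    using assms(2) unfolding rat_recursive_def by blast
  show ?thesis
    unfolding rat_recursive_def
    using total_recursive_rat_add[OF F(1) G(1)] by (auto simp: rat_seq_rat_add F(2) G(2))
qed

text \<open>Cross-multiplying and moving the subtracted parts to the other side leaves an inequality
  between naturals.\<close>

lemma recursive_pred_rat_le [rec_intros]:
  assumes "rat_recursive R" "rat_recursive S"
  shows "recursive_pred (\<lambda>p n. R p n \<le> S p n)"
proof -
  obtain F where F: "total_recursive F" "\<And>p n. R p n = rat_seq (F p n)"
    using assms(1) unfolding rat_recursive_def by metis
  obtain G where G: "total_recursive G" "\<And>p n. S p n = rat_seq (G p n)"
    using assms(2) unfolding rat_recursive_def by metis
  have *: "rat_seq u \<le> rat_seq v \<longleftrightarrow>
      pi1 (pi1 u) * Suc (pi2 v) + pi2 (pi1 v) * Suc (pi2 u) \<le>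
      pi1 (pi1 v) * Suc (pi2 u) + pi2 (pi1 u) * Suc (pi2 v)" for u v
  proof -
    have "rat_seq u \<le> rat_seq v \<longleftrightarrow>
        (real (pi1 (pi1 u)) - real (pi2 (pi1 u))) * real (Suc (pi2 v)) \<le>
        (real (pi1 (pi1 v)) - real (pi2 (pi1 v))) * real (Suc (pi2 u))"
      unfolding rat_seq_pi by (simp add: divide_simps)
    also have "\<dots> \<longleftrightarrow>
        real (pi1 (pi1 u) * Suc (pi2 v) + pi2 (pi1 v) * Suc (pi2 u)) \<le>
        real (pi1 (pi1 v) * Suc (pi2 u) + pi2 (pi1 u) * Suc (pi2 v))"
      unfolding of_nat_add of_nat_mult by argo
    finally show ?thesis unfolding of_nat_le_iff .
  qed
  show ?thesis unfolding F(2) G(2) * by (intro rec_intros F(1) G(1))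
qed

lemma rat_recursive_divide_nat [rec_intros]:
  assumes "rat_recursive R" "total_recursive K"
  shows "rat_recursive (\<lambda>p n. R p n / real (Suc (K p n)))"
proof -
  obtain F where F: "total_recursive F" "\<And>p n. R p n = rat_seq (F p n)"
    using assms(1) unfolding rat_recursive_def by metis
  show ?thesis
    unfolding rat_recursive_def
  proof (intro exI conjI allI)
    show "total_recursive (\<lambda>p n. prod_encode (pi1 (F p n), Suc (pi2 (F p n)) * Suc (K p n) - 1))"
      by (intro rec_intros F(1) assms(2))
    have "Suc (Suc a * Suc b - 1) = Suc a * Suc b" for a b
      by simp
    then show "rat_seq (prod_encode (pi1 (F p n), Suc (pi2 (F p n)) * Suc (K p n) - 1)) =
        R p n / real (Suc (K p n))" for p n
      unfolding F(2) rat_seq_pi pi1_prod_encode pi2_prod_encode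
      by (simp del: of_nat_Suc mult_Suc mult_Suc_right)
  qed
qed

lemma rat_recursive_sum [rec_intros]:
  assumes "rat_recursive (\<lambda>p z. R p (pi1 z) (pi2 z))" and K: "total_recursive K"
  shows "rat_recursive (\<lambda>p n. \<Sum>i<K p n. R p n i)"
proof -
  obtain F where F: "total_recursive F" "\<And>p z. rat_seq (F p z) = R p (pi1 z) (pi2 z)"
    using assms(1) unfolding rat_recursive_def by metis
  have F': "rat_seq (F p (prod_encode (n, i))) = R p n i" for p n i
    by (simp add: F(2))
  \<comment> \<open>The index 0 also denotes the rational 0, so it can start the summation.\<close>
  have "rat_seq 0 = 0"
    by (simp add: rat_seq_def prod_decode_def prod_decode_aux.simps)
  then have "rat_seq (rec_nat 0 (\<lambda>j r. rat_add r (F p (prod_encode (n, j)))) k) =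
      (\<Sum>i<k. R p n i)" for p n k
    by (induction k) (simp_all add: rat_seq_rat_add F')
  moreover have "total_recursive (\<lambda>p n. rec_nat 0 (\<lambda>j r. rat_add r (F p (prod_encode (n, j)))) (K p n))"
    by (intro rec_intros K total_recursive_comp[OF F(1)])
  ultimately show ?thesis unfolding rat_recursive_def by blast
qed

subsection \<open>Substituting an oracle\<close>

text \<open>Allows a name to be manufactured from a numerical parameter instead of being supplied as
  the oracle. The induction carries the parameter along as \<open>pi1 z\<close>.\<close>

lemma oracle_recursive_substitute:
  assumes "oracle_recursive \<Phi>"
    and G: "total_recursive (\<lambda>p z. G (pi1 z) (pi2 z))"
  shows "oracle_recursive (\<lambda>p z. \<Phi> (G (pi1 z)) (pi2 z))"
  using assms(1)
proof (induction rule: oracle_recursive.induct)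
  case zero
  show ?case by (rule oracle_recursive.zero)
next
  case succ
  show ?case
    using total_recursive_Suc[OF total_recursive_pi2[OF total_recursive_id]]
    by (simp add: total_recursive_def)
next
  case left
  show ?case
    using total_recursive_pi1[OF total_recursive_pi2[OF total_recursive_id]]
    by (simp add: total_recursive_def prod_decode_pi)
next
  case right
  show ?case
    using total_recursive_pi2[OF total_recursive_pi2[OF total_recursive_id]]
    by (simp add: total_recursive_def prod_decode_pi)
next
  case query
  show ?case using G by (simp add: total_recursive_def)
next
  case (pair \<Phi> \<Psi>)
  then show ?case by (intro oracle_recursive.pair)
next
  case (comp \<Phi> \<Psi>)
  from oracle_recursive.comp[OF comp.IH(1) oracle_recursive.pair[OF oracle_recursive.left comp.IH(2)]]
  show ?case by (simp flip: pi1_def)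
next
  case (prec \<Phi> \<Psi>)
  \<comment> \<open>Reassociation: recursion is run with the pair of oracle parameter and old
    parameter as its parameter.\<close>
  have "oracle_recursive (\<lambda>p z. Some (prod_encode (pi1 (pi1 z), prod_encode (pi2 (pi1 z), pi2 z))))"
    unfolding total_recursive_def[symmetric] by (intro rec_intros)
  from oracle_recursive.comp[OF prec.IH(2) this]
  have "oracle_recursive (\<lambda>p z. \<Psi> (G (pi1 (pi1 z))) (prod_encode (pi2 (pi1 z), pi2 z)))"
    by simp
  note 1 = oracle_recursive.prec[OF prec.IH(1) this]
  have "oracle_recursive (\<lambda>p z. Some (prod_encode (prod_encode (pi1 z, pi1 (pi2 z)), pi2 (pi2 z))))"
    unfolding total_recursive_def[symmetric] by (intro rec_intros)
  from oracle_recursive.comp[OF 1 this] show ?case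
    by (simp add: prod_decode_pi)
next
  case (search \<Phi>)
  have "oracle_recursive (\<lambda>p z. Some (prod_encode (pi1 (pi1 z), prod_encode (pi2 (pi1 z), pi2 z))))"
    unfolding total_recursive_def[symmetric] by (intro rec_intros)
  from oracle_recursive.search[OF oracle_recursive.comp[OF search.IH this]]
  show ?case by simp
qed

section \<open>Oracle-free forms of computable maps on numbers\<close>

text \<open>The constant sequence \<open>n\<close> is a name of \<open>n\<close> computable from
  \<open>n\<close>; substituting it and reading the output at position 0 removes the dependence on
  the oracle.\<close>

lemma computable_nat_fun_total_recursive:
  assumes "computable_map rep_nat rep_nat h"
  shows "total_recursive (\<lambda>p. h)"
proof -
  obtain \<Phi> where \<Phi>: "oracle_recursive \<Phi>"
    and h: "\<And>p x. p 0 = x \<Longrightarrow> \<exists>q. (\<forall>n. \<Phi> p n = Some (q n)) \<and> q 0 = h x"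
    using assms unfolding computable_map_def rep_nat_def by blast
  have "\<Phi> (\<lambda>_. n) 0 = Some (h n)" for n
    using h[of "\<lambda>_. n" n] by auto
  moreover have "oracle_recursive (\<lambda>p z. \<Phi> (\<lambda>_. pi1 z) (pi2 z))"
    by (rule oracle_recursive_substitute[OF \<Phi>]) (intro rec_intros)
  from oracle_recursive.comp[OF this total_recursive_pair[OF total_recursive_id
        total_recursive_const, of 0, unfolded total_recursive_def]]
  have "oracle_recursive (\<lambda>p n. \<Phi> (\<lambda>_. n) 0)"
    by simp
  ultimately show ?thesis by (simp add: total_recursive_def)
qed

lemma computable_real_fun_total_recursive:
  assumes "computable_map (rep_prod rep_nat rep_nat) rep_reals h"
  obtains D where "total_recursive (\<lambda>p. D)"
    and "\<And>a b m. \<bar>rat_seq (D (prod_encode (prod_encode (a, b), m))) - h (a, b)\<bar> \<le> 1 / 2 ^ m"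
proof -
  obtain \<Phi> where \<Phi>: "oracle_recursive \<Phi>"
    and h: "\<And>p a b. p 0 = a \<Longrightarrow> p 1 = b \<Longrightarrow>
      \<exists>q. (\<forall>n. \<Phi> p n = Some (q n)) \<and> rep_reals q (h (a, b))"
    using assms unfolding computable_map_def rep_prod_def rep_nat_def by fastforce
  \<comment> \<open>A name of a pair of numbers interleaves two names of which only the first
    entries count, that is, positions 0 and 1.\<close>
  define G where "G e i = (if i = 0 then pi1 e else pi2 e)" for e i :: nat
  define D where "D z = the (\<Phi> (G (pi1 z)) (pi2 z))" for z
  have *: "\<exists>q. (\<forall>n. \<Phi> (G e) n = Some (q n)) \<and> rep_reals q (h (pi1 e, pi2 e))" for e
    by (rule h) (simp_all add: G_def)
  have "oracle_recursive (\<lambda>p z. \<Phi> (G (pi1 z)) (pi2 z))"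
    unfolding G_def by (rule oracle_recursive_substitute[OF \<Phi>]) (intro rec_intros)
  moreover have "\<Phi> (G (pi1 z)) (pi2 z) = Some (D z)" for z
    using *[of "pi1 z"] by (auto simp: D_def)
  ultimately have "total_recursive (\<lambda>p. D)"
    by (simp add: total_recursive_def)
  moreover have "\<bar>rat_seq (D (prod_encode (prod_encode (a, b), m))) - h (a, b)\<bar> \<le> 1 / 2 ^ m" for a b m
    using *[of "prod_encode (a, b)"]
    by (auto simp: D_def rep_reals_def rep_metric_def dist_real_def)
  ultimately show ?thesis by (rule that)
qed

section \<open>Search for a decidable witness\<close>

text \<open>The tests are total, so the search cannot get stuck before the least witness. Pairing
  retains the input \<open>n\<close> for the evaluation of \<open>F\<close>.\<close>

lemma oracle_recursive_search_then:
  assumes P: "recursive_pred P" and F: "total_recursive F"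
  obtains \<Phi> where "oracle_recursive \<Phi>"
    and "\<And>p n. \<exists>z. P p (prod_encode (n, z)) \<Longrightarrow>
      \<exists>z. P p (prod_encode (n, z)) \<and> \<Phi> p n = Some (F p (prod_encode (n, z)))"
proof
  let ?\<mu> = "\<lambda>p n. mu_search (\<lambda>z. Some (if P p (prod_encode (n, z)) then 0 else 1))"
  let ?\<Phi> = "\<lambda>p n. Option.bind (Option.bind (Some n) (\<lambda>a. Option.bind (?\<mu> p n)
    (\<lambda>b. Some (prod_encode (a, b))))) (\<lambda>z. Some (F p z))"
  show "oracle_recursive ?\<Phi>"
    using P F total_recursive_id unfolding recursive_pred_def total_recursive_def
    by (intro oracle_recursive.comp oracle_recursive.pair oracle_recursive.search)
  show "\<exists>z. P p (prod_encode (n, z)) \<and> ?\<Phi> p n = Some (F p (prod_encode (n, z)))"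
    if "\<exists>z. P p (prod_encode (n, z))" for p n
  proof -
    define z where "z = (LEAST z. P p (prod_encode (n, z)))"
    have z: "P p (prod_encode (n, z))" "\<forall>m<z. \<not> P p (prod_encode (n, m))"
      using that LeastI_ex[of "\<lambda>z. P p (prod_encode (n, z))"] not_less_Least
      unfolding z_def by blast+
    then have "\<exists>z. Some (if P p (prod_encode (n, z)) then 0 else 1 :: nat) = Some 0 \<and>
        (\<forall>m<z. \<exists>k. Some (if P p (prod_encode (n, m)) then 0 else 1) = Some (Suc k))"
      by (intro exI[of _ z]) auto
    moreover have "(\<lambda>z. Some (if P p (prod_encode (n, z)) then 0 else 1 :: nat) = Some 0) =
        (\<lambda>z. P p (prod_encode (n, z)))"
      by auto
    ultimately have "?\<mu> p n = Some z"
      unfolding mu_search_def z_def by simp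
    then show ?thesis using z(1) by auto
  qed
qed

section \<open>Packings\<close>

text \<open>Each point gets a centre within half the separation distance. Two points sharing a
  centre are too close, so a packing injects into the finite set of centres.\<close>

lemma packing_bound:
  assumes "compact (UNIV :: 'a::metric_space set)"
  obtains B where "\<And>S :: 'a set. packing n UNIV S \<Longrightarrow> finite S \<and> card S \<le> B"
proof -
  have "0 < 1 / (2::real) ^ n / 2" by simp
  then obtain C :: "'a set" where C: "finite C" "UNIV \<subseteq> (\<Union>x\<in>C. ball x (1 / 2 ^ n / 2))"
    using assms unfolding compact_eq_totally_bounded by blast
  then have "\<forall>x. \<exists>c\<in>C. dist c x < 1 / 2 ^ n / 2"
    by (auto simp: subset_eq)
  then obtain c where c: "\<And>x. c x \<in> C" "\<And>x. dist (c x) x < 1 / 2 ^ n / 2"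
    by metis
  have "finite S \<and> card S \<le> card C" if S: "packing n UNIV S" for S :: "'a set"
  proof -
    have "inj_on c S"
    proof (rule inj_onI, rule ccontr)
      fix x y assume xy: "x \<in> S" "y \<in> S" "c x = c y" "x \<noteq> y"
      have "dist x y \<le> dist (c x) x + dist (c y) y"
        using dist_triangle3[of x y "c x"] xy(3) by simp
      also have "\<dots> < 1 / 2 ^ n"
        using c(2)[of x] c(2)[of y] by simp
      finally show False using S xy by (force simp: packing_def)
    qed
    then show ?thesis
      using c(1) C(1) by (meson card_inj_on_le image_subsetI inj_on_finite)
  qed
  then show ?thesis by (rule that)
qed

text \<open>Resolves the definite description in \<open>packing_number\<close>: packings are finite
  and bounded in size, so comparison by \<open>\<lesssim>\<close> is comparison of
  \<open>card\<close> and a largest one exists.\<close>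

lemma packing_number_maximum:
  assumes "compact (UNIV :: 'a::metric_space set)"
  obtains T :: "'a::metric_space set" where "packing n UNIV T" "finite T" "card T = packing_number (UNIV :: 'a set) n"
    and "\<And>S :: 'a set. packing n UNIV S \<Longrightarrow> finite S \<and> card S \<le> packing_number (UNIV :: 'a set) n"
proof -
  obtain B where B: "\<And>S :: 'a set. packing n UNIV S \<Longrightarrow> finite S \<and> card S \<le> B"
    using packing_bound[OF assms] by blast
  have "packing n UNIV ({} :: 'a set)"
    by (simp add: packing_def)
  then have "\<exists>T :: 'a set. packing n UNIV T \<and> (\<forall>S :: 'a set. packing n UNIV S \<longrightarrow> card S \<le> card T)"
    \<comment> \<open>The rule expects a strict upper bound, hence \<open>Suc B\<close>.\<close>
    by (rule ex_has_greatest_nat[of "packing n UNIV" "{} :: 'a set" card "Suc B"]) (use B in \<open>auto simp: less_Suc_eq_le\<close>)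
  then obtain T :: "'a set" where T: "packing n UNIV T" "\<And>S :: 'a set. packing n UNIV S \<Longrightarrow> card S \<le> card T"
    by blast
  have max: "maximum_packing n UNIV S \<longleftrightarrow> packing n UNIV S \<and> card S = card T" for S :: "'a set"
    unfolding maximum_packing_def
    using T B by (metis eq_imp_le le_antisym lepoll_iff_card_le)
  have "packing_number (UNIV :: 'a set) n = card T"
    unfolding packing_number_def
    by (rule the_equality) (use T max in auto)
  then show ?thesis using that T B by metis
qed

lemma packing_number_positive:
  assumes "compact (UNIV :: 'a::metric_space set)"
  shows "0 < packing_number (UNIV :: 'a set) n"
proof -
  have "packing n UNIV {undefined :: 'a}"
    by (simp add: packing_def)
  then show ?thesis
    using packing_number_maximum[OF assms, of n]
    by (metis One_nat_def card.empty card.insert empty_iff finite.emptyI less_eq_Suc_le)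
qed

text \<open>Packings as indexed families. If \<open>L\<close> is the packing number, such a family
  enumerates a maximum packing.\<close>

definition separated :: "nat \<Rightarrow> nat \<Rightarrow> (nat \<Rightarrow> 'a::metric_space) \<Rightarrow> bool" where
  "separated n L s \<longleftrightarrow> (\<forall>i<L. \<forall>j<L. i \<noteq> j \<longrightarrow> 1 / 2 ^ n < dist (s i) (s j))"

lemma separated_inj_on: "separated n L s \<Longrightarrow> inj_on s {..<L}"
  unfolding separated_def inj_on_def
  by (metis dist_self divide_pos_pos lessThan_iff not_less_iff_gr_or_eq zero_less_numeral zero_less_one zero_less_power)

text \<open>
  Exchanging the points of \<open>t\<close> near \<open>A\<close> for those of \<open>A\<close> yields another packing, which cannot
  exceed the maximum. This is Hall's condition for a matching of the two packings.
\<close>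

lemma maximum_packing_exchange:
  fixes s t :: "nat \<Rightarrow> 'a::metric_space"
  assumes "compact (UNIV :: 'a set)"
    and L: "L = packing_number (UNIV :: 'a set) n"
    and s: "separated n L s" and t: "separated n L t"
    and A: "A \<subseteq> {..<L}"
  shows "card A \<le> card {j\<in>{..<L}. \<exists>i\<in>A. dist (s i) (t j) \<le> 1 / 2 ^ n}"
proof -
  define B where "B = {j\<in>{..<L}. \<exists>i\<in>A. dist (s i) (t j) \<le> 1 / 2 ^ n}"
  define C where "C = {..<L} - B"
  have st: "1 / 2 ^ n < dist (s i) (t j)" if "i \<in> A" "j \<in> C" for i j
    using that by (force simp: B_def C_def not_le)
  have "packing n UNIV (s ` A \<union> t ` C)"
    unfolding packing_def
  proof (intro conjI ballI impI subset_UNIV)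
    fix x y assume xy: "x \<in> s ` A \<union> t ` C" "y \<in> s ` A \<union> t ` C" "x \<noteq> y"
    then consider i j where "x = s i" "y = s j" "i \<in> A" "j \<in> A" "i \<noteq> j"
      | i j where "x = s i" "y = t j" "i \<in> A" "j \<in> C"
      | i j where "x = t j" "y = s i" "i \<in> A" "j \<in> C"
      | i j where "x = t i" "y = t j" "i \<in> C" "j \<in> C" "i \<noteq> j"
      by blast
    then show "1 / 2 ^ n < dist x y"
    proof cases
      case 1
      then show ?thesis using s A unfolding separated_def by blast
    next
      case 2
      then show ?thesis using st by simp
    next
      case 3
      then show ?thesis using st by (simp add: dist_commute)
    next
      case 4
      then show ?thesis using t unfolding separated_def C_def by blast
    qed
  qed
  then have "card (s ` A \<union> t ` C) \<le> L"
    using packing_number_maximum[OF assms(1)] L by metis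
  moreover have "s ` A \<inter> t ` C = {}"
  proof -
    have "s i \<noteq> t j" if "i \<in> A" "j \<in> C" for i j
      using st[OF that] by (auto simp: not_less)
    then show ?thesis by blast
  qed
  moreover have "finite A" "finite C"
    using A finite_subset unfolding C_def by blast+
  moreover have "card (s ` A) = card A" "card (t ` C) = card C"
    using A separated_inj_on[OF s] separated_inj_on[OF t]
    unfolding C_def by (auto intro!: card_image elim: inj_on_subset)
  ultimately have "card A + card C \<le> L"
    by (simp add: card_Un_disjoint)
  moreover have "B \<subseteq> {..<L}"
    by (auto simp: B_def)
  then have "card C = L - card B" "card B \<le> L"
    using card_mono[of "{..<L}" B] finite_subset[of B "{..<L}"]
    by (auto simp: C_def card_Diff_subset)
  ultimately show ?thesis by (simp add: B_def)
qed

section \<open>Comparison of sums over two maximum packings\<close>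

text \<open>Turns a counting condition of Hall type directly into an inequality of sums. The proof
  pairs off the largest values of both functions and inducts on the rest.\<close>

lemma sum_le_if_card_superlevel_le:
  fixes f :: "'a \<Rightarrow> real" and g :: "'b \<Rightarrow> real"
  assumes "finite S" "finite T" "card S = card T"
    and "\<And>c. card {x\<in>S. c \<le> f x} \<le> card {x\<in>T. c \<le> g x}"
  shows "sum f S \<le> sum g T"
  using assms
proof (induction "card S" arbitrary: S T)
  case 0
  then show ?case by simp
next
  case (Suc n)
  have ne: "S \<noteq> {}" "T \<noteq> {}"
    using Suc.hyps(2) Suc.prems(3) by auto
  obtain s where s: "s \<in> S" "\<And>x. x \<in> S \<Longrightarrow> f x \<le> f s"
    using Max_in[of "f ` S"] Max_ge[of "f ` S"] ne Suc.prems(1) by (metis (no_types, lifting) finite_imageI image_iff image_is_empty)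
  obtain t where t: "t \<in> T" "\<And>x. x \<in> T \<Longrightarrow> g x \<le> g t"
    using Max_in[of "g ` T"] Max_ge[of "g ` T"] ne Suc.prems(2) by (metis (no_types, lifting) finite_imageI image_iff image_is_empty)
  \<comment> \<open>At level \<open>f s\<close> the superlevel set of \<open>f\<close> contains
    \<open>s\<close>, so that of \<open>g\<close> is nonempty.\<close>
  have st: "f s \<le> g t"
  proof -
    have "0 < card {x\<in>S. f s \<le> f x}"
      using s Suc.prems(1) by (auto simp: card_gt_0_iff)
    also have "\<dots> \<le> card {x\<in>T. f s \<le> g x}"
      by (rule Suc.prems)
    finally obtain x where "x \<in> T" "f s \<le> g x"
      by (auto simp: card_gt_0_iff)
    then show ?thesis using t(2) by force
  qed
  have "sum f (S - {s}) \<le> sum g (T - {t})"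
  proof (rule Suc.hyps(1))
    show "n = card (S - {s})" "finite (S - {s})" "finite (T - {t})" "card (S - {s}) = card (T - {t})"
      using Suc.hyps(2) Suc.prems s(1) t(1) by auto
    \<comment> \<open>Up to level \<open>f s\<close> both counts drop by exactly one; above it the
      left set is empty.\<close>
    show "card {x \<in> S - {s}. c \<le> f x} \<le> card {x \<in> T - {t}. c \<le> g x}" for c
    proof (cases "c \<le> f s")
      case True
      then have "c \<le> g t" using st by simp
      have "{x \<in> S - {s}. c \<le> f x} = {x \<in> S. c \<le> f x} - {s}"
        "{x \<in> T - {t}. c \<le> g x} = {x \<in> T. c \<le> g x} - {t}"
        by auto
      then show ?thesis
        using True \<open>c \<le> g t\<close> s(1) t(1) Suc.prems(4)[of c] by (simp add: diff_le_mono)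
    next
      case False
      then have "{x \<in> S - {s}. c \<le> f x} = {}"
        using s(2) by force
      then show ?thesis by (simp only: card.empty)
    qed
  qed
  then show ?case
    using st s(1) t(1) Suc.prems(1,2) by (simp add: sum.remove[of S s] sum.remove[of T t])
qed

text \<open>The exchange bound is applied to a superlevel set of \<open>f\<close>: all neighbours of
  its indices satisfy \<open>c \<le> g j + \<epsilon>\<close>. Exchanging the two packings gives the
  opposite estimate.\<close>

lemma maximum_packing_sums_close:
  fixes s t :: "nat \<Rightarrow> 'a::metric_space"
  assumes "compact (UNIV :: 'a set)"
    and L: "L = packing_number (UNIV :: 'a set) n"
    and s: "separated n L s" and t: "separated n L t"
    and close: "\<And>i j. i < L \<Longrightarrow> j < L \<Longrightarrow> dist (s i) (t j) \<le> 1 / 2 ^ n \<Longrightarrow> \<bar>f i - g j\<bar> \<le> \<epsilon>"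
  shows "\<bar>(\<Sum>i<L. f i) - (\<Sum>j<L. g j)\<bar> \<le> real L * \<epsilon>"
proof -
  have half: "(\<Sum>i<L. f i) \<le> (\<Sum>j<L. g j + \<epsilon>)"
    if s: "separated n L s" and t: "separated n L t"
    and close: "\<And>i j. i < L \<Longrightarrow> j < L \<Longrightarrow> dist (s i) (t j) \<le> 1 / 2 ^ n \<Longrightarrow> \<bar>f i - g j\<bar> \<le> \<epsilon>"
    for s t :: "nat \<Rightarrow> 'a" and f g :: "nat \<Rightarrow> real"
  proof (rule sum_le_if_card_superlevel_le)
    fix c
    have "card {i\<in>{..<L}. c \<le> f i} \<le>
        card {j\<in>{..<L}. \<exists>i\<in>{i\<in>{..<L}. c \<le> f i}. dist (s i) (t j) \<le> 1 / 2 ^ n}"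
      by (rule maximum_packing_exchange[OF assms(1) L s t]) auto
    also have "\<dots> \<le> card {j\<in>{..<L}. c \<le> g j + \<epsilon>}"
      using close by (intro card_mono) (fastforce simp: abs_le_iff)+
    finally show "card {i\<in>{..<L}. c \<le> f i} \<le> card {j\<in>{..<L}. c \<le> g j + \<epsilon>}" .
  qed auto
  have "(\<Sum>i<L. f i) \<le> (\<Sum>j<L. g j + \<epsilon>)"
    by (rule half[OF s t close])
  moreover have "(\<Sum>j<L. g j) \<le> (\<Sum>i<L. f i + \<epsilon>)"
    by (rule half[OF t s]) (metis close dist_commute abs_minus_commute)
  ultimately show ?thesis
    by (simp add: sum.distrib abs_le_iff)
qed

section \<open>Maximum packings inside the dense sequence\<close>

lemma dense_sequence_approx:
  assumes "closure (range \<xi>) = UNIV" and "0 < \<epsilon>"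
  shows "\<exists>k. dist (\<xi> k) x < \<epsilon>"
  using assms by (metis UNIV_I closure_approachable rangeE)

text \<open>Strict separation of finitely many points leaves a uniform gap, which survives small
  perturbations. The slack \<open>\<eta>\<close> lets approximate distances confirm the
  separation.\<close>

lemma dense_maximum_packing:
  fixes \<xi> :: "nat \<Rightarrow> 'a::metric_space"
  assumes "compact (UNIV :: 'a set)" and dense: "closure (range \<xi>) = UNIV"
    and L: "L = packing_number (UNIV :: 'a set) n"
  obtains a \<eta> where "0 < \<eta>"
    and "\<And>i j. i < L \<Longrightarrow> j < L \<Longrightarrow> i \<noteq> j \<Longrightarrow> 1 / 2 ^ n + \<eta> < dist (\<xi> (a i)) (\<xi> (a j))"
proof -
  obtain T :: "'a set" where T: "packing n UNIV T" "finite T" "card T = L"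
    using packing_number_maximum[OF assms(1)] L by metis
  then obtain t where t: "bij_betw t {..<L} T"
    using ex_bij_betw_nat_finite[of T] by (auto simp: atLeast0LessThan)
  define P where "P = {(i, j). i < L \<and> j < L \<and> i \<noteq> j}"
  \<comment> \<open>The inserted 1 covers the case of no pairs. Moving both points by less than
    \<open>\<delta> / 4\<close> preserves more than half the gap.\<close>
  define \<delta> where "\<delta> = Min (insert 1 ((\<lambda>(i, j). dist (t i) (t j) - 1 / 2 ^ n) ` P))"
  have fin: "finite P"
    by (rule finite_subset[of _ "{..<L} \<times> {..<L}"]) (auto simp: P_def)
  have "1 / 2 ^ n < dist (t i) (t j)" if "(i, j) \<in> P" for i j
  proof -
    have "t i \<in> T" "t j \<in> T" "t i \<noteq> t j"
      using that t by (auto simp: P_def bij_betw_def inj_on_def)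
    then show ?thesis using T(1) by (auto simp: packing_def)
  qed
  then have "0 < \<delta>"
    using fin by (auto simp: \<delta>_def)
  have \<delta>: "1 / 2 ^ n + \<delta> \<le> dist (t i) (t j)" if "i < L" "j < L" "i \<noteq> j" for i j
  proof -
    have "(i, j) \<in> P" using that by (simp add: P_def)
    then have "\<delta> \<le> dist (t i) (t j) - 1 / 2 ^ n"
      unfolding \<delta>_def using fin by (intro Min_le) force+
    then show ?thesis by simp
  qed
  have "\<exists>k. dist (\<xi> k) (t i) < \<delta> / 4" for i
    using \<open>0 < \<delta>\<close> by (intro dense_sequence_approx[OF dense]) simp
  then obtain a where a: "\<And>i. dist (\<xi> (a i)) (t i) < \<delta> / 4"
    by metis
  show ?thesis
  proof (rule that[of "\<delta> / 4" a])
    fix i j assume "i < L" "j < L" "i \<noteq> j"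
    from \<delta>[OF this] show "1 / 2 ^ n + \<delta> / 4 < dist (\<xi> (a i)) (\<xi> (a j))"
      using a[of i] a[of j] \<open>0 < \<delta>\<close> dist_triangle[of "t i" "t j" "\<xi> (a i)"]
        dist_triangle[of "\<xi> (a i)" "t j" "\<xi> (a j)"]
      by (simp add: dist_commute)
  qed (use \<open>0 < \<delta>\<close> in simp)
qed

section \<open>Averages over packings approximate the Haar integral\<close>

lemma continuous_mul_left:
  assumes "topological_group mul e minv"
  shows "continuous_on UNIV (mul g)"
proof -
  have "continuous_on UNIV ((\<lambda>(x, y). mul x y) \<circ> (\<lambda>y. (g, y)))"
    using assms unfolding topological_group_def
    by (intro continuous_on_compose continuous_intros) (auto elim: continuous_on_subset)
  then show ?thesis by (simp add: o_def)
qed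

text \<open>Invariance is postulated for images; the preimage under translation by \<open>g\<close>
  is the image under translation by \<open>minv g\<close>, so translation preserves
  \<open>\<mu>\<close>.\<close>

lemma haar_integral_mul_left:
  fixes f :: "'a::topological_space \<Rightarrow> real"
  assumes G: "topological_group mul e minv" and H: "haar_probability mul \<mu>"
    and f: "f \<in> borel_measurable borel"
  shows "(\<integral>x. f (mul g x) \<partial>\<mu>) = (\<integral>x. f x \<partial>\<mu>)"
proof -
  have sets: "sets \<mu> = sets borel" and space: "space \<mu> = UNIV"
    using H sets_eq_imp_space_eq[of \<mu> borel] by (auto simp: haar_probability_def)
  interpret group mul e minv
    using G by (simp add: topological_group_def)
  have m: "mul h \<in> measurable borel borel" for h
    by (intro borel_measurable_continuous_onI continuous_mul_left[OF G])
  have m': "mul g \<in> measurable \<mu> \<mu>"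
    using m by (simp add: measurable_cong_sets[OF sets sets])
  have "distr \<mu> \<mu> (mul g) = \<mu>"
  proof (rule measure_eqI)
    fix A assume "A \<in> sets (distr \<mu> \<mu> (mul g))"
    then have A: "A \<in> sets \<mu>" by simp
    have "mul g -` A = mul (minv g) ` A"
    proof (intro equalityI subsetI)
      fix x assume "x \<in> mul g -` A"
      moreover have "x = mul (minv g) (mul g x)"
        by (simp flip: assoc)
      ultimately show "x \<in> mul (minv g) ` A" by auto
    next
      fix x assume "x \<in> mul (minv g) ` A"
      then show "x \<in> mul g -` A"
        by (auto simp flip: assoc)
    qed
    then show "emeasure (distr \<mu> \<mu> (mul g)) A = emeasure \<mu> A"
      using H A m' sets by (simp add: emeasure_distr space haar_probability_def)
  qed simp
  moreover have "f \<in> borel_measurable \<mu>"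
    using f by (simp add: measurable_cong_sets[OF sets refl])
  ultimately show ?thesis
    using integral_distr[OF m', of f] by simp
qed

text \<open>Right translations are isometries, so all translates \<open>mul (t i) x\<close> form
  maximum packings; as functions of \<open>x\<close> they are left translations, so each summand
  integrates to the Haar integral. One value \<open>v j\<close> serves the whole ball around
  \<open>t j\<close>.\<close>

lemma haar_integral_packing_average:
  fixes f :: "'a::metric_space \<Rightarrow> real"
  assumes K: "compact (UNIV :: 'a set)"
    and G: "topological_group mul e minv" and "bi_invariant mul"
    and H: "haar_probability mul \<mu>" and f: "continuous_on UNIV f"
    and L: "L = packing_number (UNIV :: 'a set) n" and t: "separated n L t"
    and close: "\<And>j y. j < L \<Longrightarrow> dist y (t j) \<le> 1 / 2 ^ n \<Longrightarrow> \<bar>f y - v j\<bar> \<le> \<epsilon>"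
  shows "\<bar>(\<Sum>j<L. v j) / real L - (\<integral>x. f x \<partial>\<mu>)\<bar> \<le> \<epsilon>"
proof -
  interpret prob_space \<mu>
    using H by (simp add: haar_probability_def)
  have sets: "sets \<mu> = sets borel"
    using H by (auto simp: haar_probability_def)
  define F where "F x = (\<Sum>i<L. f (mul (t i) x))" for x
  have "0 < L"
    using packing_number_positive[OF K] L by simp
  have bound: "\<bar>F x - (\<Sum>j<L. v j)\<bar> \<le> real L * \<epsilon>" for x
    unfolding F_def
  proof (rule maximum_packing_sums_close[OF K L])
    show "separated n L (\<lambda>i. mul (t i) x)"
      using t \<open>bi_invariant mul\<close> by (simp add: separated_def bi_invariant_def)
  qed (use t close in auto)
  have int: "integrable \<mu> (\<lambda>x. f (mul (t i) x))" for i
  proof -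
    have c: "continuous_on UNIV (\<lambda>x. f (mul (t i) x))"
      using continuous_on_compose[OF continuous_mul_left[OF G, of "t i"]]
        continuous_on_subset[OF f] by (auto simp: o_def)
    then obtain B where "\<And>x. norm (f (mul (t i) x)) \<le> B"
      using compact_imp_bounded[OF compact_continuous_image[OF c K]]
      unfolding bounded_iff by auto
    moreover have "(\<lambda>x. f (mul (t i) x)) \<in> borel_measurable \<mu>"
      using borel_measurable_continuous_onI[OF c] by (simp add: measurable_cong_sets[OF sets refl])
    ultimately show ?thesis
      by (intro integrable_const_bound[of _ B]) auto
  qed
  then have intF: "integrable \<mu> F"
    unfolding F_def by auto
  have "(\<integral>x. F x \<partial>\<mu>) = real L * (\<integral>x. f x \<partial>\<mu>)"
    unfolding F_def using int
    by (simp add: haar_integral_mul_left[OF G H borel_measurable_continuous_onI[OF f]])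
  \<comment> \<open>The bound on \<open>F\<close> is uniform in \<open>x\<close>, so it passes to
    the integral against a probability measure.\<close>
  moreover have "(\<Sum>j<L. v j) - real L * \<epsilon> \<le> (\<integral>x. F x \<partial>\<mu>)"
    by (rule integral_ge_const[OF intF]) (use bound in \<open>auto simp: abs_le_iff algebra_simps\<close>)
  moreover have "(\<integral>x. F x \<partial>\<mu>) \<le> (\<Sum>j<L. v j) + real L * \<epsilon>"
    by (rule integral_le_const[OF intF]) (use bound in \<open>auto simp: abs_le_iff algebra_simps\<close>)
  ultimately have "\<bar>(\<Sum>j<L. v j) - real L * (\<integral>x. f x \<partial>\<mu>)\<bar> \<le> real L * \<epsilon>"
    by (simp add: abs_le_iff)
  then have "\<bar>(\<Sum>j<L. v j) - real L * (\<integral>x. f x \<partial>\<mu>)\<bar> / real L \<le> \<epsilon>"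
    using \<open>0 < L\<close> by (simp add: divide_le_eq mult.commute)
  also have "\<bar>(\<Sum>j<L. v j) - real L * (\<integral>x. f x \<partial>\<mu>)\<bar> / real L =
      \<bar>(\<Sum>j<L. v j) / real L - (\<integral>x. f x \<partial>\<mu>)\<bar>"
  proof -
    have "(\<Sum>j<L. v j) / real L - (\<integral>x. f x \<partial>\<mu>) = ((\<Sum>j<L. v j) - real L * (\<integral>x. f x \<partial>\<mu>)) / real L"
      using \<open>0 < L\<close> by (simp add: diff_divide_distrib)
    then show ?thesis by (simp add: abs_divide)
  qed
  finally show ?thesis .
qed

section \<open>Certificates\<close>

text \<open>The condition of \<open>kleene_apply\<close> at one output position, restricted to the
  finite prefix actually read.\<close>

definition decides :: "(nat \<Rightarrow> nat) \<Rightarrow> nat \<Rightarrow> (nat \<Rightarrow> nat) \<Rightarrow> nat \<Rightarrow> bool" where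
  "decides p n w k \<longleftrightarrow>
    p (prod_encode (n, list_encode (map w [0..<k]))) \<noteq> 0 \<and>
    (\<forall>j<k. p (prod_encode (n, list_encode (map w [0..<j]))) = 0)"

lemma decides_cong:
  assumes "\<And>j. j < k \<Longrightarrow> w j = w' j"
  shows "decides p n w k = decides p n w' k"
proof -
  have "map w [0..<j] = map w' [0..<j]" if "j \<le> k" for j
    using that assms by simp
  then have "(\<forall>j<k. p (prod_encode (n, list_encode (map w [0..<j]))) = 0) \<longleftrightarrow>
      (\<forall>j<k. p (prod_encode (n, list_encode (map w' [0..<j]))) = 0)"
      "map w [0..<k] = map w' [0..<k]"
    by (metis less_imp_le, blast)
  then show ?thesis unfolding decides_def by (simp only:)
qed

text \<open>The prefix extends to a genuine name of \<open>x\<close>. On that name the associate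
  stops at the same prefix, so its answer must be an approximation of \<open>f x\<close>.\<close>

lemma decides_value:
  fixes \<xi> :: "nat \<Rightarrow> 'a::metric_space"
  assumes dense: "closure (range \<xi>) = UNIV" and f: "rep_fun (rep_metric \<xi>) rep_reals p f"
    and w: "decides p n w k" and x: "\<And>j. j < k \<Longrightarrow> dist (\<xi> (w j)) x \<le> 1 / 2 ^ j"
  shows "\<bar>f x - rat_seq (p (prod_encode (n, list_encode (map w [0..<k]))) - 1)\<bar> \<le> 1 / 2 ^ n"
proof -
  have "\<exists>i. dist (\<xi> i) x < 1 / 2 ^ j" for j
    by (intro dense_sequence_approx[OF dense]) simp
  then obtain u where u: "\<And>j. dist (\<xi> (u j)) x < 1 / 2 ^ j"
    by metis
  define q where "q j = (if j < k then w j else u j)" for j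
  have "rep_metric \<xi> q x"
    using x u by (auto simp: rep_metric_def q_def intro: less_imp_le)
  then obtain r where "kleene_apply p q r" and r: "rep_reals r (f x)"
    using f unfolding rep_fun_def by blast
  then obtain k' where k': "p (prod_encode (n, list_encode (map q [0..<k']))) = Suc (r n)"
      "\<forall>j<k'. p (prod_encode (n, list_encode (map q [0..<j]))) = 0"
    unfolding kleene_apply_def by blast
  have "decides p n q k"
    using w decides_cong[of k w q] by (simp add: q_def)
  \<comment> \<open>Both are the first length with a nonzero answer.\<close>
  then have "k' = k"
    using k' unfolding decides_def by (metis Zero_neq_Suc linorder_neqE_nat)
  moreover have "map q [0..<k] = map w [0..<k]"
    by (simp add: q_def)
  ultimately have "p (prod_encode (n, list_encode (map w [0..<k]))) = Suc (r n)"
    using k'(1) by (simp only:)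
  then show ?thesis
    using r by (simp add: rep_reals_def rep_metric_def dist_real_def abs_minus_commute)
qed

text \<open>Names converging twice as fast as demanded leave room around each point: its deciding
  prefix stays valid nearby, with slack. Compactness reduces to finitely many prefixes and hence a
  common scale.\<close>

lemma decides_uniformly:
  fixes \<xi> :: "nat \<Rightarrow> 'a::metric_space"
  assumes K: "compact (UNIV :: 'a set)" and dense: "closure (range \<xi>) = UNIV"
    and f: "rep_fun (rep_metric \<xi>) rep_reals p f"
  obtains N where "\<And>y. \<exists>w k. decides p n w k \<and> (\<forall>j<k. dist y (\<xi> (w j)) + 1 / 2 ^ N \<le> 1 / 2 ^ j)"
proof -
  have "\<exists>w k. decides p n w k \<and> (\<forall>j<k. dist x (\<xi> (w j)) \<le> 1 / 2 ^ j / 2)" for x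
  proof -
    have "\<exists>i. dist (\<xi> i) x < 1 / 2 ^ j / 2" for j
      by (intro dense_sequence_approx[OF dense]) simp
    then obtain u where u: "\<And>j. dist (\<xi> (u j)) x < 1 / 2 ^ j / 2"
      by metis
    have "dist (\<xi> (u j)) x \<le> 1 / 2 ^ j" for j
    proof (rule order.trans)
      show "dist (\<xi> (u j)) x \<le> 1 / 2 ^ j / 2"
        using u by (rule less_imp_le)
    qed (simp add: divide_simps)
    then obtain r where "kleene_apply p u r"
      using f unfolding rep_fun_def rep_metric_def by blast
    then obtain k where "decides p n u k"
      unfolding kleene_apply_def decides_def by (metis Zero_neq_Suc)
    then show ?thesis
      using u by (metis dist_commute less_imp_le)
  qed
  then obtain w k where w: "\<And>x. decides p n (w x) (k x)"
    "\<And>x j. j < k x \<Longrightarrow> dist x (\<xi> (w x j)) \<le> 1 / 2 ^ j / 2"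
    by metis
  have "\<exists>D\<subseteq>UNIV. finite D \<and> UNIV \<subseteq> (\<Union>x\<in>D. ball x (1 / 2 ^ k x / 4))"
    by (rule compactE_image[OF K, of UNIV "\<lambda>x. ball x (1 / 2 ^ k x / 4)"])
      (auto intro!: exI[of _ "_::'a"])
  then obtain D where D: "finite D" "UNIV \<subseteq> (\<Union>x\<in>D. ball x (1 / 2 ^ k x / 4))"
    by blast
  \<comment> \<open>The \<open>+ 2\<close> gives \<open>1 / 2 ^ N \<le> 1 / 2 ^ k x / 4\<close>.
    With the ball radius this costs at most \<open>1 / 2 ^ k x / 2\<close>, which is at most
    \<open>1 / 2 ^ j / 4\<close> for \<open>j < k x\<close>.\<close>
  define N where "N = Max (insert 0 (k ` D)) + 2"
  have N: "k x + 2 \<le> N" if "x \<in> D" for x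
    using that D(1) by (simp add: N_def)
  show ?thesis
  proof (rule that[of N])
    fix y
    obtain x where x: "x \<in> D" "dist x y < 1 / 2 ^ k x / 4"
      using D(2) by (auto simp: subset_eq)
    have "dist y (\<xi> (w x j)) + 1 / 2 ^ N \<le> 1 / 2 ^ j" if "j < k x" for j
    proof -
      define E :: "nat \<Rightarrow> real" where "E m = 1 / 2 ^ m" for m
      have E_Suc: "E (Suc m) = E m / 2" and E_pos: "0 < E m" for m
        by (simp_all add: E_def)
      have "(1::real) / 2 ^ N \<le> 1 / 2 ^ Suc (Suc (k x))"
        using N[OF x(1)] by (intro divide_left_mono power_increasing) auto
      moreover have "(1::real) / 2 ^ k x \<le> 1 / 2 ^ Suc j"
        using that by (intro divide_left_mono power_increasing) auto
      moreover have "dist y (\<xi> (w x j)) \<le> dist x y + dist x (\<xi> (w x j))"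
        by (metis dist_commute dist_triangle)
      ultimately show ?thesis
        using w(2)[OF that] x(2) E_pos[of j] unfolding E_def[symmetric] E_Suc by linarith
    qed
    then show "\<exists>w k. decides p n w k \<and> (\<forall>j<k. dist y (\<xi> (w j)) + 1 / 2 ^ N \<le> 1 / 2 ^ j)"
      using w(1) by blast
  qed
qed

text \<open>
  The search variable \<open>z\<close> codes a scale \<open>N\<close>, a precision \<open>M\<close> for the distances, the points of a
  maximum packing at scale \<open>N\<close>, and for each of these points \<open>x\<close> a deciding word together with its
  length, such that the word starts a name of every point of the ball of radius \<open>1 / 2 ^ N\<close> at \<open>x\<close>.
\<close>

definition scale :: "nat \<Rightarrow> nat" where "scale z = pi1 (pi1 z)"
definition precision :: "nat \<Rightarrow> nat" where "precision z = pi2 (pi1 z)"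
definition point :: "nat \<Rightarrow> nat \<Rightarrow> nat" where "point z i = nth_code (pi1 (pi2 z)) i"
definition wcode :: "nat \<Rightarrow> nat \<Rightarrow> nat" where "wcode z i = nth_code (pi1 (pi2 (pi2 z))) i"
definition wlen :: "nat \<Rightarrow> nat \<Rightarrow> nat" where "wlen z i = nth_code (pi2 (pi2 (pi2 z))) i"

lemmas certificate_parts = scale_def precision_def point_def wcode_def wlen_def

definition answer :: "(nat \<Rightarrow> nat) \<Rightarrow> nat \<Rightarrow> nat \<Rightarrow> nat \<Rightarrow> nat" where
  "answer p n c k = p (prod_encode (n, prefix_code c k))"

text \<open>Both distance tests put the error of \<open>d\<close> on the safe side: passing them
  implies the exact inequalities. Comparisons are phrased by \<open>\<le>\<close> and negation,
  matching the decidability rules.\<close>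

definition certificate ::
    "(nat \<Rightarrow> nat) \<Rightarrow> (nat \<Rightarrow> nat \<Rightarrow> nat \<Rightarrow> real) \<Rightarrow> (nat \<Rightarrow> nat) \<Rightarrow> nat \<Rightarrow> nat \<Rightarrow> bool" where
  "certificate \<kappa> d p n z \<longleftrightarrow>
    (\<forall>i<\<kappa> (scale z). \<forall>j<\<kappa> (scale z). \<not> i = j \<longrightarrow>
      \<not> d (point z i) (point z j) (precision z) \<le> 1 / 2 ^ scale z + 1 / 2 ^ precision z) \<and>
    (\<forall>i<\<kappa> (scale z). \<not> answer p n (wcode z i) (wlen z i) = 0 \<and>
      (\<forall>j<wlen z i. answer p n (wcode z i) j = 0 \<and>
        d (point z i) (nth_code (wcode z i) j) (precision z) +
          (1 / 2 ^ precision z + 1 / 2 ^ scale z) \<le> 1 / 2 ^ j))"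

text \<open>The inner \<open>- 1\<close> undoes the \<open>Suc\<close> in answers of associates.
  \<open>Suc (\<kappa> (scale z) - 1)\<close> is a positive packing number in the form of a coded
  denominator.\<close>

definition certified_average :: "(nat \<Rightarrow> nat) \<Rightarrow> (nat \<Rightarrow> nat) \<Rightarrow> nat \<Rightarrow> nat \<Rightarrow> real" where
  "certified_average \<kappa> p n z =
    (\<Sum>i<\<kappa> (scale z). rat_seq (answer p n (wcode z i) (wlen z i) - 1)) / real (Suc (\<kappa> (scale z) - 1))"

lemma recursive_certificate:
  assumes \<kappa>: "total_recursive (\<lambda>p. \<kappa>)" and D: "total_recursive (\<lambda>p. D)"
  shows "recursive_pred (\<lambda>p x. certificate \<kappa>
      (\<lambda>a b m. rat_seq (D (prod_encode (prod_encode (a, b), m)))) p (pi1 x) (pi2 x))"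
  unfolding certificate_def certificate_parts answer_def
  by (intro rec_intros total_recursive_comp[OF \<kappa>] total_recursive_comp[OF D])

lemma rat_recursive_certified_average:
  assumes \<kappa>: "total_recursive (\<lambda>p. \<kappa>)"
  shows "rat_recursive (\<lambda>p x. certified_average \<kappa> p (pi1 x) (pi2 x))"
  unfolding certified_average_def certificate_parts answer_def
  by (intro rec_intros total_recursive_comp[OF \<kappa>])

lemma decides_answer:
  "decides p n (nth_code c) k \<longleftrightarrow> answer p n c k \<noteq> 0 \<and> (\<forall>j<k. answer p n c j = 0)"
  by (simp add: decides_def answer_def prefix_code_def)

section \<open>Soundness and existence of certificates\<close>

text \<open>The number of separated points makes them a maximum packing. By the triangle inequality
  each word begins a name of every point in the ball, so its answer approximates \<open>f\<close> on
  that ball; the error is \<open>1 / 2 ^ n\<close> whatever the scale.\<close>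

lemma certificate_sound:
  fixes f :: "'a::metric_space \<Rightarrow> real"
  assumes K: "compact (UNIV :: 'a set)" and dense: "closure (range \<xi>) = UNIV"
    and G: "topological_group mul e minv" "bi_invariant mul" "haar_probability mul \<mu>"
    and f: "rep_continuous \<xi> p f"
    and d: "\<And>a b m. \<bar>d a b m - dist (\<xi> a) (\<xi> b)\<bar> \<le> 1 / 2 ^ m"
    and cert: "certificate (packing_number (UNIV :: 'a set)) d p n z"
  shows "\<bar>certified_average (packing_number (UNIV :: 'a set)) p n z - (\<integral>x. f x \<partial>\<mu>)\<bar> \<le> 1 / 2 ^ n"
proof -
  let ?L = "packing_number (UNIV :: 'a set) (scale z)"
  let ?v = "\<lambda>i. rat_seq (answer p n (wcode z i) (wlen z i) - 1)"
  have "\<bar>(\<Sum>i<?L. ?v i) / real ?L - (\<integral>x. f x \<partial>\<mu>)\<bar> \<le> 1 / 2 ^ n"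
  proof (rule haar_integral_packing_average[OF K G _ refl])
    show "continuous_on UNIV f"
      using f by (simp add: rep_continuous_def)
    show "separated (scale z) ?L (\<lambda>i. \<xi> (point z i))"
      unfolding separated_def
    proof (intro allI impI)
      fix i j assume "i < ?L" "j < ?L" "i \<noteq> j"
      then have "\<not> d (point z i) (point z j) (precision z) \<le> 1 / 2 ^ scale z + 1 / 2 ^ precision z"
        using cert unfolding certificate_def by blast
      then show "1 / 2 ^ scale z < dist (\<xi> (point z i)) (\<xi> (point z j))"
        using d[of "point z i" "point z j" "precision z"] by linarith
    qed
  next
    fix i y assume i: "i < ?L" and y: "dist y (\<xi> (point z i)) \<le> 1 / 2 ^ scale z"
    have "decides p n (nth_code (wcode z i)) (wlen z i)"
      using cert i unfolding certificate_def decides_answer by blast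
    moreover have "dist (\<xi> (nth_code (wcode z i) j)) y \<le> 1 / 2 ^ j" if "j < wlen z i" for j
    proof -
      have "d (point z i) (nth_code (wcode z i) j) (precision z) +
          (1 / 2 ^ precision z + 1 / 2 ^ scale z) \<le> 1 / 2 ^ j"
        using cert i that unfolding certificate_def by blast
      then show ?thesis
        using d[of "point z i" "nth_code (wcode z i) j" "precision z"] y
          dist_triangle2[of "\<xi> (nth_code (wcode z i) j)" y "\<xi> (point z i)"]
        by (simp add: dist_commute)
    qed
    ultimately show "\<bar>f y - ?v i\<bar> \<le> 1 / 2 ^ n"
      unfolding answer_def prefix_code_def
      using f by (intro decides_value[OF dense]) (auto simp: rep_continuous_def)
  qed
  then show ?thesis
    using packing_number_positive[OF K, of "scale z"] by (simp add: certified_average_def)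
qed

text \<open>The choices are made in order: a scale from uniform decidability, a packing at that
  scale with slack \<open>\<eta>\<close>, and then a precision fine enough for both.\<close>

lemma certificate_exists:
  fixes f :: "'a::metric_space \<Rightarrow> real"
  assumes K: "compact (UNIV :: 'a set)" and dense: "closure (range \<xi>) = UNIV"
    and f: "rep_continuous \<xi> p f"
    and d: "\<And>a b m. \<bar>d a b m - dist (\<xi> a) (\<xi> b)\<bar> \<le> 1 / 2 ^ m"
  shows "\<exists>z. certificate (packing_number (UNIV :: 'a set)) d p n z"
proof -
  obtain N0 where "\<And>y. \<exists>w k. decides p n w k \<and> (\<forall>j<k. dist y (\<xi> (w j)) + 1 / 2 ^ N0 \<le> 1 / 2 ^ j)"
    using decides_uniformly[OF K dense] f unfolding rep_continuous_def by blast
  then obtain w k where w: "\<And>y. decides p n (w y) (k y)"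
    "\<And>y j. j < k y \<Longrightarrow> dist y (\<xi> (w y j)) + 1 / 2 ^ N0 \<le> 1 / 2 ^ j"
    by metis
  \<comment> \<open>The available slack becomes \<open>4 / 2 ^ N\<close>. The second test consumes
    at most three quarters of it: one for the ball, two for the distance error and its safety
    margin.\<close>
  define N where "N = N0 + 2"
  define L where "L = packing_number (UNIV :: 'a set) N"
  obtain a \<eta> where \<eta>: "0 < \<eta>"
    and a: "\<And>i j. i < L \<Longrightarrow> j < L \<Longrightarrow> i \<noteq> j \<Longrightarrow> 1 / 2 ^ N + \<eta> < dist (\<xi> (a i)) (\<xi> (a j))"
    using dense_maximum_packing[OF K dense L_def] by metis
  \<comment> \<open>In the separation test the error of \<open>d\<close> counts twice against
    \<open>\<eta>\<close>.\<close>
  obtain M0 where M0: "1 / 2 ^ M0 < \<eta> / 2"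
    using \<eta> real_arch_pow_inv[of "\<eta> / 2" "1 / 2"] by (auto simp: power_one_over)
  define M where "M = max N M0"
  have M: "1 / 2 ^ M < \<eta> / 2" "(1::real) / 2 ^ M \<le> 1 / 2 ^ N"
  proof -
    have "(1::real) / 2 ^ M \<le> 1 / 2 ^ M0"
      by (intro divide_left_mono power_increasing) (auto simp: M_def)
    then show "1 / 2 ^ M < \<eta> / 2" using M0 by simp
    show "(1::real) / 2 ^ M \<le> 1 / 2 ^ N"
      by (intro divide_left_mono power_increasing) (auto simp: M_def)
  qed
  obtain ac where ac: "\<And>i. i < L \<Longrightarrow> nth_code ac i = a i"
    using ex_nth_code[of L a] by blast
  have "\<exists>c. \<forall>j<k y. nth_code c j = w y j" for y
    by (rule ex_nth_code)
  then obtain c where c: "\<And>y j. j < k y \<Longrightarrow> nth_code (c y) j = w y j"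
    by metis
  obtain wc where wc: "\<And>i. i < L \<Longrightarrow> nth_code wc i = c (\<xi> (a i))"
    using ex_nth_code[of L "\<lambda>i. c (\<xi> (a i))"] by blast
  obtain kc where kc: "\<And>i. i < L \<Longrightarrow> nth_code kc i = k (\<xi> (a i))"
    using ex_nth_code[of L "\<lambda>i. k (\<xi> (a i))"] by blast
  define z where "z = prod_encode (prod_encode (N, M), prod_encode (ac, prod_encode (wc, kc)))"
  have z: "scale z = N" "precision z = M" "\<And>i. i < L \<Longrightarrow> point z i = a i"
    "\<And>i. i < L \<Longrightarrow> wcode z i = c (\<xi> (a i))" "\<And>i. i < L \<Longrightarrow> wlen z i = k (\<xi> (a i))"
    by (simp_all add: z_def certificate_parts ac wc kc)
  have "\<not> d (a i) (a j) M \<le> 1 / 2 ^ N + 1 / 2 ^ M" if "i < L" "j < L" "i \<noteq> j" for i j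
    using a[OF that] M(1) d[of "a i" "a j" M] by linarith
  moreover have "answer p n (c y) (k y) \<noteq> 0 \<and> (\<forall>j<k y. answer p n (c y) j = 0)" for y
    using w(1)[of y] decides_cong[of "k y" "nth_code (c y)" "w y"] c
    unfolding decides_answer[symmetric] by blast
  moreover have "d (a i) (nth_code (c (\<xi> (a i))) j) M + (1 / 2 ^ M + 1 / 2 ^ N) \<le> 1 / 2 ^ j"
    if "j < k (\<xi> (a i))" for i j
  proof -
    have "4 * (1 / 2 ^ N) = (1::real) / 2 ^ N0" "0 \<le> (1::real) / 2 ^ N"
      by (simp_all add: N_def power_add)
    then show ?thesis
      using w(2)[OF that] M(2) d[of "a i" "w (\<xi> (a i)) j" M]
      unfolding c[OF that] by linarith
  qed
  ultimately have "certificate (packing_number (UNIV :: 'a set)) d p n z"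
    by (simp add: certificate_def z flip: L_def)
  then show ?thesis ..
qed

section \<open>Computability of the Haar integral\<close>

theorem theorem4:
  fixes \<xi> :: "nat \<Rightarrow> 'a::metric_space"
    and mul :: "'a \<Rightarrow> 'a \<Rightarrow> 'a" and e :: 'a and minv :: "'a \<Rightarrow> 'a"
    and \<mu> :: "'a measure"
  assumes "computable_metric_space \<xi>"
    and "topological_group mul e minv"
    and "compact (UNIV :: 'a set)"
    and "bi_invariant mul"
    and "computable_map rep_nat rep_nat (packing_number (UNIV :: 'a set))"
    and "haar_probability mul \<mu>"
  shows "computable_map (rep_continuous \<xi>) rep_reals (\<lambda>f. integral\<^sup>L \<mu> f)"
proof -
  let ?\<kappa> = "packing_number (UNIV :: 'a set)"
  have dense: "closure (range \<xi>) = UNIV"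
    using assms(1) by (simp add: computable_metric_space_def)
  obtain D where D: "total_recursive (\<lambda>p. D)"
    and D_dist: "\<And>a b m. \<bar>rat_seq (D (prod_encode (prod_encode (a, b), m))) - dist (\<xi> a) (\<xi> b)\<bar> \<le> 1 / 2 ^ m"
    using computable_real_fun_total_recursive[of "\<lambda>(a, b). dist (\<xi> a) (\<xi> b)"] assms(1)
    by (auto simp: computable_metric_space_def)
  let ?d = "\<lambda>a b m. rat_seq (D (prod_encode (prod_encode (a, b), m)))"
  note \<kappa> = computable_nat_fun_total_recursive[OF assms(5)]
  obtain F where F: "total_recursive F"
    "\<And>p x. rat_seq (F p x) = certified_average ?\<kappa> p (pi1 x) (pi2 x)"
    using rat_recursive_certified_average[OF \<kappa>] unfolding rat_recursive_def by blast
  \<comment> \<open>For each output position \<open>n\<close> a separate search finds a certificate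
    and returns an index of its rational average.\<close>
  obtain \<Phi> where \<Phi>: "oracle_recursive \<Phi>"
    and search: "\<And>p n. \<exists>z. certificate ?\<kappa> ?d p n z \<Longrightarrow>
      \<exists>z. certificate ?\<kappa> ?d p n z \<and> \<Phi> p n = Some (F p (prod_encode (n, z)))"
    using oracle_recursive_search_then[OF recursive_certificate[OF \<kappa> D] F(1)] by auto
  show ?thesis
    unfolding computable_map_def
  proof (intro exI[of _ \<Phi>] conjI \<Phi> allI impI)
    fix p f assume f: "rep_continuous \<xi> p f"
    have "\<exists>q. \<Phi> p n = Some q \<and> \<bar>rat_seq q - (\<integral>x. f x \<partial>\<mu>)\<bar> \<le> 1 / 2 ^ n" for n
    proof -
      \<comment> \<open>The certificate found may differ from the one constructed for existence;
        soundness covers every certificate.\<close>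
      obtain z where "certificate ?\<kappa> ?d p n z" "\<Phi> p n = Some (F p (prod_encode (n, z)))"
        using search[OF certificate_exists[OF assms(3) dense f, of ?d, OF D_dist]] by blast
      then show ?thesis
        using certificate_sound[OF assms(3) dense assms(2,4,6) f, of ?d, OF D_dist] by (simp add: F(2))
    qed
    then obtain q where "\<And>n. \<Phi> p n = Some (q n)" "\<And>n. \<bar>rat_seq (q n) - (\<integral>x. f x \<partial>\<mu>)\<bar> \<le> 1 / 2 ^ n"
      by metis
    then show "\<exists>q. (\<forall>n. \<Phi> p n = Some (q n)) \<and> rep_reals q (integral\<^sup>L \<mu> f)"
      by (auto simp: rep_reals_def rep_metric_def dist_real_def)
  qed
qed

end
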